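(* Let $q$ be a prime power, $n\ge 6$ an even integer, and let $\mathcal L$ be a non-trivial intriguing set in the Grassmann graph of planes of ${\rm PG}(n,q)$ which is not tight. If $n=6$, then $|\mathcal L|\ge (q+1)^2(q^3-1)/(q-1)$, and if $n\ge 8$, then $|\mathcal L|\ge q(q^{n-2}-1)/(q^2-1)$. *)

theory Defs
  imports "HOL-Analysis.Analysis" "HOL-Number_Theory.Prime_Powers"
begin

text \<open>A finite simple graph is given by its vertex set \<open>V\<close> and a symmetric, irreflexive
  adjacency relation \<open>adj\<close>.\<close>

definition neighbours :: "'v set \<Rightarrow> ('v \<Rightarrow> 'v \<Rightarrow> bool) \<Rightarrow> 'v \<Rightarrow> 'v set" where
  "neighbours V adj v = {w \<in> V. adj v w}"

text \<open>Eigenvalues of the adjacency matrix; an eigenvector is a real function on \<open>V\<close>.  The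
  matrix is symmetric, so all its eigenvalues are real.\<close>

definition graph_eigenvalue :: "'v set \<Rightarrow> ('v \<Rightarrow> 'v \<Rightarrow> bool) \<Rightarrow> real \<Rightarrow> bool" where
  "graph_eigenvalue V adj \<theta> \<longleftrightarrow>
     (\<exists>f :: 'v \<Rightarrow> real. (\<exists>v\<in>V. f v \<noteq> 0) \<and>
        (\<forall>v\<in>V. (\<Sum>w\<in>neighbours V adj v. f w) = \<theta> * f v))"

text \<open>Second largest among the distinct eigenvalues.  In a connected regular graph the largest
  eigenvalue is simple, so counting eigenvalues with multiplicity gives the same number.\<close>

definition second_largest_eigenvalue :: "'v set \<Rightarrow> ('v \<Rightarrow> 'v \<Rightarrow> bool) \<Rightarrow> real \<Rightarrow> bool" where
  "second_largest_eigenvalue V adj \<theta> \<longleftrightarrow>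
     graph_eigenvalue V adj \<theta> \<and>
     (\<exists>\<kappa>. graph_eigenvalue V adj \<kappa> \<and> \<theta> < \<kappa> \<and>
        (\<forall>\<mu>. graph_eigenvalue V adj \<mu> \<longrightarrow> \<mu> = \<kappa> \<or> \<mu> \<le> \<theta>))"

definition smallest_eigenvalue :: "'v set \<Rightarrow> ('v \<Rightarrow> 'v \<Rightarrow> bool) \<Rightarrow> real \<Rightarrow> bool" where
  "smallest_eigenvalue V adj \<theta> \<longleftrightarrow>
     graph_eigenvalue V adj \<theta> \<and> (\<forall>\<mu>. graph_eigenvalue V adj \<mu> \<longrightarrow> \<theta> \<le> \<mu>)"

definition intriguing_with ::
  "'v set \<Rightarrow> ('v \<Rightarrow> 'v \<Rightarrow> bool) \<Rightarrow> nat \<Rightarrow> nat \<Rightarrow> 'v set \<Rightarrow> bool" where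
  "intriguing_with V adj h1 h2 L \<longleftrightarrow>
     L \<subseteq> V \<and>
     (\<forall>v\<in>L. card (neighbours V adj v \<inter> L) = h1) \<and>
     (\<forall>v\<in>V - L. card (neighbours V adj v \<inter> L) = h2)"

definition intriguing :: "'v set \<Rightarrow> ('v \<Rightarrow> 'v \<Rightarrow> bool) \<Rightarrow> 'v set \<Rightarrow> bool" where
  "intriguing V adj L \<longleftrightarrow> (\<exists>h1 h2. intriguing_with V adj h1 h2 L)"

definition nontrivial_vertex_set :: "'v set \<Rightarrow> 'v set \<Rightarrow> bool" where
  "nontrivial_vertex_set V L \<longleftrightarrow> L \<noteq> {} \<and> L \<noteq> V"

text \<open>Tightness in the sense of De Bruyn and Suzuki: \<open>h1 - h2\<close> is the second largest eigenvalue
  (type I) or the smallest one (type II).  For a non-trivial set the parameters \<open>h1\<close> and \<open>h2\<close>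
  are determined by \<open>L\<close>, so the existential quantifier involves no choice.\<close>

definition tight :: "'v set \<Rightarrow> ('v \<Rightarrow> 'v \<Rightarrow> bool) \<Rightarrow> 'v set \<Rightarrow> bool" where
  "tight V adj L \<longleftrightarrow>
     (\<exists>h1 h2. intriguing_with V adj h1 h2 L \<and>
        (second_largest_eigenvalue V adj (real h1 - real h2) \<or>
         smallest_eigenvalue V adj (real h1 - real h2)))"

text \<open>\<open>PG(n,q)\<close> is the geometry of subspaces of \<open>'a ^ 'd\<close>, where \<open>'a\<close> is a field of order \<open>q\<close>
  and \<open>CARD('d) = n + 1\<close>: lines and planes are the subspaces of vector space dimension 2 and 3.\<close>

definition planes :: "('a::field ^ 'd::finite) set set" where
  "planes = {U. vec.subspace U \<and> vec.dim U = 3}"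

definition meet_in_line :: "('a::field ^ 'd::finite) set \<Rightarrow> ('a ^ 'd) set \<Rightarrow> bool" where
  "meet_in_line U W \<longleftrightarrow> U \<noteq> W \<and> vec.dim (U \<inter> W) = 2"

end

theory Submission
  imports Defs
begin

text \<open>A non-trivial intriguing set L has an edge leaving it, since the Grassmann graph is connected,
  so the parameter h2 is positive: every vertex outside L has a neighbour in L.  With v planes,
  each having k neighbours, this gives v \<open>\<le>\<close> (k + 1) |L|, and the Gaussian-binomial values
  of v and k yield the bounds.  The one exception is n = 6, q = 2, where v = 11811, k = 210 and
  counting the edges that meet L gives |L| (210 - h1 + h2) = 11811 h2.  If |L| were below 63, the
  prime factor 127 of 11811 would have to divide 210 - h1 + h2, hence 210 - h1 + h2 = 254 and
  2 |L| = 93 h2, which is impossible.\<close>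

section \<open>Finite vector spaces: cardinality, adjoining a vector, intermediate
  dimensions\<close>

lemma card_span_independent:
  fixes B :: "('a::{field,finite} ^ 'd::finite) set"
  assumes "vec.independent B"
  shows "card (vec.span B) = CARD('a) ^ card B"
proof -
  have "finite B" by simp
  from this assms show ?thesis
  proof (induction B rule: finite_induct)
    case empty
    then show ?case by simp
  next
    case (insert b B)
    have ind: "vec.independent B" and b: "b \<notin> vec.span B"
      using insert.prems insert.hyps by (auto simp: vec.independent_insert)
    \<comment> \<open>This map is a bijection from the field times \<open>vec.span B\<close> onto
      \<open>vec.span (insert b B)\<close>, so each basis vector contributes a factor
      \<open>CARD('a)\<close>.\<close>
    let ?f = "\<lambda>(k::'a, x). k *s b + x"
    have "inj_on ?f (UNIV \<times> vec.span B)"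
    proof (rule inj_onI, clarify)
      fix k l x y
      assume x: "x \<in> vec.span B" and y: "y \<in> vec.span B" and eq: "k *s b + x = l *s b + y"
      have "(k - l) *s b = y - x"
        using eq by (simp add: vec.scale_left_diff_distrib algebra_simps)
      then have *: "(k - l) *s b \<in> vec.span B"
        using x y by (simp add: vec.span_diff)
      have "k = l"
      proof (rule ccontr)
        assume "k \<noteq> l"
        then show False
          using vec.span_scale[OF *, of "inverse (k - l)"] b
          by (simp only: vec.scale_scale left_inverse right_minus_eq vec.scale_one simp_thms)
      qed
      then show "k = l \<and> x = y" using eq by simp
    qed
    moreover have "?f ` (UNIV \<times> vec.span B) = vec.span (insert b B)"
    proof (intro equalityI subsetI)
      fix y assume "y \<in> vec.span (insert b B)"
      then obtain k where "y - k *s b \<in> vec.span B" by (auto simp: vec.span_insert)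
      then show "y \<in> ?f ` (UNIV \<times> vec.span B)"
        by (intro image_eqI[of _ _ "(k, y - k *s b)"]) auto
    next
      fix y assume "y \<in> ?f ` (UNIV \<times> vec.span B)"
      then obtain k x where "y = k *s b + x" "x \<in> vec.span B" by auto
      then have "y - k *s b \<in> vec.span B" by simp
      then show "y \<in> vec.span (insert b B)" by (auto simp: vec.span_insert)
    qed
    ultimately have "card (vec.span (insert b B)) = card ((UNIV :: 'a set) \<times> vec.span B)"
      by (metis card_image)
    then show ?case using insert ind by (simp add: card_cartesian_product)
  qed
qed

lemma card_subspace:
  fixes S :: "('a::{field,finite} ^ 'd::finite) set"
  assumes "vec.subspace S"
  shows "card S = CARD('a) ^ vec.dim S"
  using card_span_independent vec.basis_exists vec.span_eq_iff assms
  by (metis vec.span_subspace)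

lemma dim_span_insert:
  fixes S :: "('a::field ^ 'd::finite) set"
  assumes "vec.subspace S" "x \<notin> S"
  shows "vec.dim (vec.span (insert x S)) = Suc (vec.dim S)"
  using assms by (simp add: vec.dim_insert vec.span_eq_iff[THEN iffD2])

text \<open>If k x + s lies in T with s in S, then k x lies in T, and x outside T forces k = 0. This
  is how a subspace with a prescribed intersection with T is built, both for counting extensions and
  for walking through the Grassmann graph.\<close>

lemma span_insert_Int:
  fixes S :: "('a::field ^ 'd::finite) set"
  assumes "vec.subspace S" "vec.subspace T" "S \<subseteq> T" "x \<notin> T"
  shows "vec.span (insert x S) \<inter> T = S"
proof
  show "vec.span (insert x S) \<inter> T \<subseteq> S"
  proof
    fix y assume y: "y \<in> vec.span (insert x S) \<inter> T"
    then obtain k where k: "y - k *s x \<in> S"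
      using assms(1) by (auto simp: vec.span_insert vec.span_eq_iff[THEN iffD2])
    have "k *s x \<in> T"
      using vec.subspace_diff[OF assms(2), of y "y - k *s x"] y k assms(3) by auto
    then have "k = 0"
      using assms(4) vec.subspace_scale[OF assms(2), of "k *s x" "inverse k"]
      by (metis vec.scale_scale left_inverse vec.scale_one)
    then show "y \<in> S" using k by simp
  qed
  show "S \<subseteq> vec.span (insert x S) \<inter> T"
    using assms(3) vec.span_superset by blast
qed

lemma intermediate_subspace:
  fixes S :: "('a::field ^ 'd::finite) set"
  assumes "vec.subspace S" "vec.subspace T" "S \<subseteq> T" "vec.dim S \<le> m" "m \<le> vec.dim T"
  obtains R where "vec.subspace R" "S \<subseteq> R" "R \<subseteq> T" "vec.dim R = m"
proof -
  have "\<exists>R. vec.subspace R \<and> S \<subseteq> R \<and> R \<subseteq> T \<and> vec.dim R = m"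
    using assms(4,5)
  proof (induction m rule: dec_induct)
    case base
    then show ?case using assms by blast
  next
    case (step m)
    then obtain R where R: "vec.subspace R" "S \<subseteq> R" "R \<subseteq> T" "vec.dim R = m" by auto
    with step.prems have "R \<noteq> T" by auto
    with R obtain x where x: "x \<in> T" "x \<notin> R" by auto
    have "vec.span (insert x R) \<subseteq> T"
      using R x assms(2) by (simp add: vec.span_minimal)
    moreover have "S \<subseteq> vec.span (insert x R)"
      using R(2) vec.span_superset by blast
    ultimately show ?case
      using dim_span_insert[OF R(1) x(2)] R(4) vec.subspace_span by blast
  qed
  then show ?thesis using that by blast
qed

lemma real_card_Diff:
  fixes A :: "'b::finite set"
  assumes "A \<subseteq> B"
  shows "real (card (B - A)) = real (card B) - real (card A)"
  using assms by (simp add: card_Diff_subset card_mono of_nat_diff)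

section \<open>Counting the points, lines and planes of a subspace\<close>

definition subspaces_in :: "nat \<Rightarrow> ('a::field ^ 'd::finite) set \<Rightarrow> ('a ^ 'd) set set" where
  "subspaces_in m T = {W. vec.subspace W \<and> vec.dim W = m \<and> W \<subseteq> T}"

text \<open>The sets W - S partition R - T: a vector x in R - T lies in exactly one such W, namely
  \<open>vec.span (insert x S)\<close>, and all pieces have the same size. Taking T = S counts all W
  in R that contain S; taking for T a plane and for S one of its lines counts the planes that meet T
  exactly in S.\<close>

lemma card_extensions:
  fixes S T R :: "('a::{field,finite} ^ 'd::finite) set"
  assumes S: "vec.subspace S" and T: "vec.subspace T" and R: "vec.subspace R"
    and ST: "S \<subseteq> T" and TR: "T \<subseteq> R"
  shows "real (card {W \<in> subspaces_in (Suc (vec.dim S)) R. W \<inter> T = S})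
           * (real CARD('a) ^ Suc (vec.dim S) - real CARD('a) ^ vec.dim S)
         = real CARD('a) ^ vec.dim R - real CARD('a) ^ vec.dim T"
    (is "real (card ?A) * ?c = _")
proof -
  have W_eq: "W = vec.span (insert x S)" if "W \<in> ?A" "x \<in> W - S" for W x
  proof -
    have W: "vec.subspace W" "vec.dim W = Suc (vec.dim S)" "S \<subseteq> W"
      using that by (auto simp: subspaces_in_def)
    then have "vec.span (insert x S) \<subseteq> W"
      using that by (intro vec.span_minimal) auto
    then show ?thesis
      using W that dim_span_insert[OF S, of x]
        vec.subspace_dim_equal[of "vec.span (insert x S)" W] by auto
  qed
  have "R - T = (\<Union>W\<in>?A. W - S)"
  proof
    show "R - T \<subseteq> (\<Union>W\<in>?A. W - S)"
    proof
      fix x assume x: "x \<in> R - T"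
      have "vec.span (insert x S) \<subseteq> R"
        using x ST TR R by (intro vec.span_minimal) auto
      then have "vec.span (insert x S) \<in> ?A"
        using x ST dim_span_insert[OF S, of x] span_insert_Int[OF S T ST, of x]
        by (auto simp: subspaces_in_def)
      moreover have "x \<in> vec.span (insert x S) - S"
        using x ST by (auto simp: vec.span_base)
      ultimately show "x \<in> (\<Union>W\<in>?A. W - S)" by blast
    qed
    show "(\<Union>W\<in>?A. W - S) \<subseteq> R - T"
      by (auto simp: subspaces_in_def)
  qed
  then have "real (card (R - T)) = card (\<Union>W\<in>?A. W - S)" by simp
  also have "card (\<Union>W\<in>?A. W - S) = (\<Sum>W\<in>?A. card (W - S))"
  proof (rule card_UN_disjoint)
    show "\<forall>W\<in>?A. \<forall>W'\<in>?A. W \<noteq> W' \<longrightarrow> (W - S) \<inter> (W' - S) = {}"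
    proof (intro ballI impI equals0I)
      fix W W' x
      assume W: "W \<in> ?A" "W' \<in> ?A" "W \<noteq> W'" and x: "x \<in> (W - S) \<inter> (W' - S)"
      from x have "x \<in> W - S" "x \<in> W' - S" by simp_all
      from W_eq[OF W(1) this(1)] W_eq[OF W(2) this(2)] W(3) show False by simp
    qed
  qed auto
  also have "real (\<Sum>W\<in>?A. card (W - S)) = (\<Sum>W\<in>?A. ?c)"
    unfolding of_nat_sum
  proof (rule sum.cong)
    fix W assume "W \<in> ?A"
    then have "vec.subspace W" "vec.dim W = Suc (vec.dim S)" "S \<subseteq> W"
      by (auto simp: subspaces_in_def)
    then show "real (card (W - S)) = ?c"
      using card_subspace[of W] card_subspace[OF S] real_card_Diff[of S W] by simp
  qed simp
  finally show ?thesis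
    using card_subspace[OF R] card_subspace[OF T] TR real_card_Diff[OF TR] by simp
qed

text \<open>Double counting of the flags S \<subseteq> W in T with dimensions m and m + 1. Knowing
  the number c of m-subspaces in each W, one passes from the count in dimension m to that in
  dimension m + 1.\<close>

lemma card_flags:
  fixes T :: "('a::{field,finite} ^ 'd::finite) set"
  assumes T: "vec.subspace T"
    and c: "\<And>W. W \<in> subspaces_in (Suc m) T \<Longrightarrow> card (subspaces_in m W) = c"
  shows "real (card (subspaces_in m T)) * (real CARD('a) ^ vec.dim T - real CARD('a) ^ m)
         = real (card (subspaces_in (Suc m) T)) * real c * (real CARD('a) ^ Suc m - real CARD('a) ^ m)"
proof -
  let ?d = "real CARD('a) ^ Suc m - real CARD('a) ^ m"
  have "real (card (subspaces_in m T)) * (real CARD('a) ^ vec.dim T - real CARD('a) ^ m)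
        = (\<Sum>S\<in>subspaces_in m T. card {W \<in> subspaces_in (Suc m) T. S \<subseteq> W} * ?d)"
  proof -
    have "card {W \<in> subspaces_in (Suc m) T. S \<subseteq> W} * ?d = real CARD('a) ^ vec.dim T - real CARD('a) ^ m"
      if "S \<in> subspaces_in m T" for S
    proof -
      have S: "vec.subspace S" "vec.dim S = m" "S \<subseteq> T"
        using that by (auto simp: subspaces_in_def)
      \<comment> \<open>With T := S in \<open>card_extensions\<close>, the intersection condition
        becomes plain containment.\<close>
      have "W \<inter> S = S \<longleftrightarrow> S \<subseteq> W" for W by blast
      then show ?thesis using card_extensions[OF S(1) S(1) T order_refl S(3)] S(2) by simp
    qed
    then show ?thesis by simp
  qed
  also have "\<dots> = real (\<Sum>S\<in>subspaces_in m T. card {W \<in> subspaces_in (Suc m) T. S \<subseteq> W}) * ?d"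
    by (simp add: sum_distrib_right)
  also have "(\<Sum>S\<in>subspaces_in m T. card {W \<in> subspaces_in (Suc m) T. S \<subseteq> W})
        = c * card (subspaces_in (Suc m) T)"
  proof (rule sum_multicount)
    show "\<forall>W\<in>subspaces_in (Suc m) T. card {S \<in> subspaces_in m T. S \<subseteq> W} = c"
    proof
      fix W assume W: "W \<in> subspaces_in (Suc m) T"
      then have "{S \<in> subspaces_in m T. S \<subseteq> W} = subspaces_in m W"
        by (auto simp: subspaces_in_def)
      then show "card {S \<in> subspaces_in m T. S \<subseteq> W} = c" using c[OF W] by simp
    qed
  qed auto
  finally show ?thesis by (simp add: mult_ac)
qed

lemma card_subspaces_in_0:
  fixes T :: "('a::field ^ 'd::finite) set"
  assumes "vec.subspace T"
  shows "card (subspaces_in 0 T) = 1"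
proof -
  have "subspaces_in 0 T = {{0}}"
    using assms vec.subspace_0 by (fastforce simp: subspaces_in_def vec.dim_eq_0)
  then show ?thesis by simp
qed

lemma card_subspaces_in_1:
  fixes T :: "('a::{field,finite} ^ 'd::finite) set" and q t :: real
  assumes T: "vec.subspace T"
  defines "q \<equiv> real CARD('a)" and "t \<equiv> real CARD('a) ^ vec.dim T"
  shows "real (card (subspaces_in 1 T)) * (q - 1) = t - 1"
proof -
  have "card (subspaces_in 0 W) = 1" if "W \<in> subspaces_in (Suc 0) T" for W
    by (rule card_subspaces_in_0) (use that in \<open>simp add: subspaces_in_def\<close>)
  from card_flags[OF T this] show ?thesis
    by (simp add: card_subspaces_in_0[OF T] q_def t_def)
qed

lemma card_field_gt_1: "real CARD('a::{field,finite}) > 1"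
proof -
  have "card {0::'a, 1} \<le> CARD('a)" by (intro card_mono) auto
  then show ?thesis by simp
qed

text \<open>Flags of a point on a line, each line having q + 1 points. Up to a common factor q, both
  sides count the ordered bases of lines: (q^2 - 1)(q^2 - q) per line on the left, (t - 1)(t - q)
  independent pairs in T on the right.\<close>

lemma card_subspaces_in_2:
  fixes T :: "('a::{field,finite} ^ 'd::finite) set" and q t :: real
  assumes T: "vec.subspace T"
  defines "q \<equiv> real CARD('a)" and "t \<equiv> real CARD('a) ^ vec.dim T"
  shows "real (card (subspaces_in 2 T)) * ((q - 1) * (q^2 - 1) * q) = (t - 1) * (t - q)"
proof -
  have q: "q > 1" unfolding q_def by (rule card_field_gt_1)
  have c: "card (subspaces_in (Suc 0) W) = CARD('a) + 1" if "W \<in> subspaces_in (Suc (Suc 0)) T" for W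
  proof -
    have "real (card (subspaces_in 1 W)) * (q - 1) = (q + 1) * (q - 1)"
      using that card_subspaces_in_1[of W] 
      by (auto simp: subspaces_in_def q_def power2_eq_square algebra_simps)
    then have "real (card (subspaces_in 1 W)) = real (CARD('a) + 1)"
      using q by (simp add: q_def)
    then show ?thesis by (simp only: of_nat_eq_iff One_nat_def)
  qed
  have "real (card (subspaces_in 1 T)) * (t - q) = real (card (subspaces_in 2 T)) * (q + 1) * (q^2 - q)"
    using card_flags[OF T c] by (simp add: q_def t_def numeral_2_eq_2 algebra_simps)
  \<comment> \<open>The extra factor q - 1 completes the left side to that of
    \<open>card_subspaces_in_1\<close>, and (q + 1)(q - 1) = q^2 - 1 appears on the right.\<close>
  then have "(real (card (subspaces_in 1 T)) * (q - 1)) * (t - q)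
      = real (card (subspaces_in 2 T)) * ((q - 1) * (q^2 - 1) * q)"
    by algebra
  then show ?thesis
    using card_subspaces_in_1[OF T] unfolding q_def t_def by metis
qed

lemma card_lines_of_plane:
  fixes W :: "('a::{field,finite} ^ 'd::finite) set"
  assumes "vec.subspace W" "vec.dim W = 3"
  shows "card (subspaces_in 2 W) = CARD('a)^2 + CARD('a) + 1"
proof -
  define q where "q = real CARD('a)"
  have q: "q > 1" unfolding q_def by (rule card_field_gt_1)
  have "real (card (subspaces_in 2 W)) * ((q - 1) * (q^2 - 1) * q) = (q^3 - 1) * (q^3 - q)"
    using card_subspaces_in_2[OF assms(1)] assms(2) by (simp add: q_def)
  also have "\<dots> = (q^2 + q + 1) * ((q - 1) * (q^2 - 1) * q)" by algebra
  finally have "real (card (subspaces_in 2 W)) = q^2 + q + 1"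
    using q by (simp add: power2_eq_1_iff)
  then have "real (card (subspaces_in 2 W)) = real (CARD('a)^2 + CARD('a) + 1)"
    by (simp add: q_def)
  then show ?thesis by (simp only: of_nat_eq_iff)
qed

text \<open>Flags of a line in a plane. The coefficient equals (q^3 - 1)(q^3 - q)(q^3 - q^2), the
  number of ordered bases of a 3-space, so this is the Gaussian binomial coefficient cleared of its
  denominator.\<close>

lemma card_subspaces_in_3:
  fixes T :: "('a::{field,finite} ^ 'd::finite) set" and q t :: real
  assumes T: "vec.subspace T"
  defines "q \<equiv> real CARD('a)" and "t \<equiv> real CARD('a) ^ vec.dim T"
  shows "real (card (subspaces_in 3 T)) * ((q - 1) * (q^2 - 1) * (q^3 - 1) * q^3)
         = (t - 1) * (t - q) * (t - q^2)"
proof -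
  have c: "card (subspaces_in 2 W) = CARD('a)^2 + CARD('a) + 1" if "W \<in> subspaces_in (Suc 2) T" for W
    by (rule card_lines_of_plane) (use that in \<open>simp_all add: subspaces_in_def\<close>)
  have "real (card (subspaces_in 2 T)) * (t - q^2)
      = real (card (subspaces_in 3 T)) * (q^2 + q + 1) * (q^3 - q^2)"
    using card_flags[OF T c] by (simp add: q_def t_def numeral_3_eq_3 numeral_2_eq_2)
  then have "(real (card (subspaces_in 2 T)) * ((q - 1) * (q^2 - 1) * q)) * (t - q^2)
      = real (card (subspaces_in 3 T)) * ((q - 1) * (q^2 - 1) * (q^3 - 1) * q^3)"
    by algebra
  then show ?thesis
    using card_subspaces_in_2[OF T] by (simp add: q_def t_def)
qed

section \<open>The Grassmann graph of planes: order, degree and connectedness\<close>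

lemma dim_UNIV: "vec.dim (UNIV :: ('a::field ^ 'd::finite) set) = CARD('d)"
  by (simp only: vec.dim_UNIV vec.dimension_def card_cart_basis)

lemma planes_eq: "planes = subspaces_in 3 UNIV"
  by (auto simp: planes_def subspaces_in_def)

lemma card_planes:
  fixes q t :: real
  defines "q \<equiv> real CARD('a)" and "t \<equiv> real CARD('a) ^ CARD('d)"
  shows "real (card (planes :: ('a::{field,finite} ^ 'd::finite) set set))
           * ((q - 1) * (q^2 - 1) * (q^3 - 1) * q^3) = (t - 1) * (t - q) * (t - q^2)"
  using card_subspaces_in_3[OF vec.subspace_UNIV, where 'a='a and 'd='d]
  by (simp add: planes_eq dim_UNIV q_def t_def del: vec.dim_UNIV)

lemma plane_adjacent_iff:
  assumes "U \<in> planes" "W \<in> planes"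
  shows "meet_in_line U W \<longleftrightarrow> vec.dim (U \<inter> W) = 2"
  using assms by (auto simp: planes_def meet_in_line_def)

text \<open>The neighbours of U are sorted by the line l in which they meet U. There are q^2 + q + 1
  choices of l, and \<open>card_extensions\<close> gives the same number of planes for each. Since
  the result does not depend on U, the graph is regular.\<close>

lemma card_neighbours_plane:
  fixes U :: "('a::{field,finite} ^ 'd::finite) set" and q t :: real
  assumes U: "U \<in> planes"
  defines "q \<equiv> real CARD('a)" and "t \<equiv> real CARD('a) ^ CARD('d)"
  shows "real (card (neighbours planes meet_in_line U)) * (q^3 - q^2) = (q^2 + q + 1) * (t - q^3)"
proof -
  have sU: "vec.subspace U" "vec.dim U = 3" using U by (auto simp: planes_def)
  let ?E = "\<lambda>l. {W \<in> subspaces_in 3 UNIV. W \<inter> U = l}"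
  have "neighbours planes meet_in_line U = (\<Union>l\<in>subspaces_in 2 U. ?E l)"
    using U sU
    by (auto simp: neighbours_def plane_adjacent_iff planes_eq subspaces_in_def Int_commute
        vec.subspace_inter meet_in_line_def)
  then have "card (neighbours planes meet_in_line U) = card (\<Union>l\<in>subspaces_in 2 U. ?E l)"
    by simp
  also have "\<dots> = (\<Sum>l\<in>subspaces_in 2 U. card (?E l))"
    by (rule card_UN_disjoint) auto
  finally have "real (card (neighbours planes meet_in_line U)) * (q^3 - q^2)
      = (\<Sum>l\<in>subspaces_in 2 U. real (card (?E l)) * (q^3 - q^2))"
    by (simp add: sum_distrib_right)
  also have "\<dots> = (\<Sum>l\<in>subspaces_in 2 U. t - q^3)"
  proof (rule sum.cong)
    fix l assume "l \<in> subspaces_in 2 U"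
    then have l: "vec.subspace l" "l \<subseteq> U" "vec.dim l = 2" by (auto simp: subspaces_in_def)
    show "real (card (?E l)) * (q^3 - q^2) = t - q^3"
      using card_extensions[OF l(1) sU(1) vec.subspace_UNIV l(2)] l(3) sU(2)
      by (simp add: q_def t_def dim_UNIV del: vec.dim_UNIV)
  qed simp
  also have "\<dots> = (q^2 + q + 1) * (t - q^3)"
    using card_lines_of_plane[OF sU] by (simp add: q_def)
  finally show ?thesis .
qed

text \<open>If no edge left L, then from any U in L other than W one could step to a neighbour V,
  again in L, that meets W in a larger subspace. Repeating this would reach W itself, which is not
  in L.\<close>

lemma planes_connected:
  fixes L :: "('a::field ^ 'd::finite) set set"
  assumes U: "U \<in> L" and L: "L \<subseteq> planes" and W: "W \<in> planes" "W \<notin> L"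
  obtains A B where "A \<in> L" "B \<in> planes - L" "meet_in_line A B"
proof (rule ccontr)
  assume "\<not> thesis"
  with that have none: "B \<in> L" if "A \<in> L" "B \<in> planes" "meet_in_line A B" for A B
    using that by blast
  have "W \<in> L" if "U \<in> L" for U
    using that
  proof (induction "3 - vec.dim (U \<inter> W)" arbitrary: U rule: less_induct)
    case less
    have pU: "U \<in> planes" using less.prems L by blast
    then have sU: "vec.subspace U" "vec.dim U = 3" by (auto simp: planes_def)
    have sW: "vec.subspace W" "vec.dim W = 3" using W by (auto simp: planes_def)
    have sUW: "vec.subspace (U \<inter> W)" using sU sW by (simp add: vec.subspace_inter)
    show ?case
    proof (cases "U = W")
      case True
      then show ?thesis using less.prems by simp
    next
      case False
      have "vec.dim (U \<inter> W) \<noteq> 3"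
        using vec.subspace_dim_equal[of "U \<inter> W" U] vec.subspace_dim_equal[of "U \<inter> W" W]
          sU sW sUW False by auto
      moreover have "vec.dim (U \<inter> W) \<le> 3"
        using vec.dim_subset[of "U \<inter> W" U] sU by auto
      ultimately have le2: "vec.dim (U \<inter> W) \<le> 2" by simp
      have "\<not> W \<subseteq> U"
        using vec.subspace_dim_equal[of W U] sU sW False by auto
      then obtain w where w: "w \<in> W" "w \<notin> U" by blast
      obtain l where l: "vec.subspace l" "U \<inter> W \<subseteq> l" "l \<subseteq> U" "vec.dim l = 2"
        using intermediate_subspace[OF sUW sU(1) _ le2] sU by auto
      \<comment> \<open>V keeps a line l of U that contains U \<inter> W and gains the vector w of
        W. It meets U exactly in l, hence is a neighbour of U, while V \<inter> W contains both U
        \<inter> W and w.\<close>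
      define V where "V = vec.span (insert w l)"
      have VU: "V \<inter> U = l" unfolding V_def using span_insert_Int[OF l(1) sU(1) l(3) w(2)] .
      have "vec.dim V = 3"
        unfolding V_def using dim_span_insert[OF l(1), of w] l w by auto
      then have pV: "V \<in> planes" by (simp add: planes_def V_def)
      have "V \<in> L"
        using none[OF less.prems pV] plane_adjacent_iff[OF pU pV] VU l(4) by (simp add: Int_commute)
      have "insert w (U \<inter> W) \<subseteq> V \<inter> W"
        unfolding V_def using w l(2) by (auto intro: vec.span_base)
      then have "vec.dim (insert w (U \<inter> W)) \<le> vec.dim (V \<inter> W)"
        by (rule vec.dim_subset)
      \<comment> \<open>The set \<open>insert w (U \<inter> W)\<close> is not a subspace in general;
        its \<open>vec.dim\<close> is that of its span.\<close>
      moreover have "vec.dim (insert w (U \<inter> W)) = Suc (vec.dim (U \<inter> W))"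
        using dim_span_insert[OF sUW, of w] w by simp
      ultimately have "3 - vec.dim (V \<inter> W) < 3 - vec.dim (U \<inter> W)"
        using le2 by simp
      then show ?thesis using less.hyps \<open>V \<in> L\<close> by blast
    qed
  qed
  then show False using U W by blast
qed

section \<open>Edge counting for an intriguing set in a regular graph\<close>

lemma intriguing_count:
  assumes fin: "finite V" and sym: "\<And>v w. adj v w \<Longrightarrow> adj w v"
    and reg: "\<And>v. v \<in> V \<Longrightarrow> card (neighbours V adj v) = k"
    and L: "intriguing_with V adj h1 h2 L"
  shows "int (card L) * (int k - int h1 + int h2) = int (card V) * int h2"
proof -
  have LV: "L \<subseteq> V" and h1: "\<And>v. v \<in> L \<Longrightarrow> card (neighbours V adj v \<inter> L) = h1"
    and h2: "\<And>v. v \<in> V - L \<Longrightarrow> card (neighbours V adj v \<inter> L) = h2"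
    using L by (auto simp: intriguing_with_def)
  have finL: "finite L" using fin LV by (rule finite_subset[rotated])
  \<comment> \<open>Both sides count the adjacent pairs (v, w) with v in L and w in V. The left one
    evaluates by regularity, the right one by splitting V into L and its complement.\<close>
  have "(\<Sum>v\<in>L. card {w\<in>V. adj v w}) = (\<Sum>w\<in>V. card {v\<in>L. adj v w})"
    by (rule sum_multicount_gen) (use fin finL in auto)
  moreover have "(\<Sum>v\<in>L. card {w\<in>V. adj v w}) = card L * k"
    using reg LV by (simp add: neighbours_def subset_eq)
  moreover have "(\<Sum>w\<in>V. card {v\<in>L. adj v w}) = (\<Sum>w\<in>V. card (neighbours V adj w \<inter> L))"
    using LV sym by (intro sum.cong arg_cong[where f = card]) (auto simp: neighbours_def)
  moreover have "\<dots> = (\<Sum>w\<in>L. h1) + (\<Sum>w\<in>V - L. h2)"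
    using sum.subset_diff[OF LV fin, of "\<lambda>w. card (neighbours V adj w \<inter> L)"] h1 h2 by simp
  ultimately have "card L * k = card L * h1 + (card V - card L) * h2"
    using LV finL by (simp add: card_Diff_subset)
  then have "int (card L * k) = int (card L * h1 + (card V - card L) * h2)" by simp
  then show ?thesis
    using card_mono[OF fin LV] by (simp only: of_nat_add of_nat_mult of_nat_diff) algebra
qed

text \<open>An edge leaving L makes h2 at least 1, so |V| - |L| \<le> (|V| - |L|) h2 = |L| (k - h1)
  \<le> |L| k. The bounds on h1 and h2 hold because each counts a subset of L; they serve the
  exceptional case n = 6, q = 2.\<close>

lemma nontrivial_intriguing_bounds:
  assumes fin: "finite V" and sym: "\<And>v w. adj v w \<Longrightarrow> adj w v"
    and reg: "\<And>v. v \<in> V \<Longrightarrow> card (neighbours V adj v) = k"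
    and L: "intriguing_with V adj h1 h2 L"
    and nontriv: "nontrivial_vertex_set V L"
    and edge: "v \<in> L" "w \<in> V - L" "adj v w"
  shows "0 < h2" "h1 \<le> card L" "h2 \<le> card L" "card V \<le> card L * (k + 1)"
proof -
  have finL: "finite L" and LV: "L \<subseteq> V"
    using L fin by (auto simp: intriguing_with_def intro: finite_subset)
  have h1: "card (neighbours V adj v \<inter> L) = h1" and h2: "card (neighbours V adj w \<inter> L) = h2"
    using L edge by (auto simp: intriguing_with_def)
  have "v \<in> neighbours V adj w \<inter> L"
    using edge LV sym by (auto simp: neighbours_def)
  then show h2_pos: "0 < h2"
    using h2 finL by (metis card_gt_0_iff empty_iff finite_Int)
  show "h1 \<le> card L" "h2 \<le> card L"
    using h1 h2 card_mono[OF finL, of "neighbours V adj _ \<inter> L"] by auto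
  have "int (card V) - int (card L) \<le> (int (card V) - int (card L)) * int h2"
    using h2_pos card_mono[OF fin LV] mult_left_mono[of 1 "int h2" "int (card V) - int (card L)"]
    by simp
  also have "\<dots> = int (card L) * (int k - int h1)"
    using intriguing_count[OF fin sym reg L] by (simp add: algebra_simps)
  also have "\<dots> \<le> int (card L) * int k"
    by (intro mult_left_mono) auto
  finally have "int (card V) \<le> int (card L * (k + 1))" by (simp add: algebra_simps)
  then show "card V \<le> card L * (k + 1)" by (simp only: of_nat_le_iff)
qed

section \<open>Real estimates of the two counts, with \<open>a\<close> in the role of q^(n -
  2)\<close>

lemma plane_counts_bounds:
  fixes q a v k :: real
  assumes q: "q \<ge> 2" and a: "a \<ge> 1"
    and v: "v * ((q - 1) * (q^2 - 1) * (q^3 - 1) * q^3)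
      = (q^3 * a - 1) * (q^3 * a - q) * (q^3 * a - q^2)"
    and k: "k * (q^3 - q^2) = (q^2 + q + 1) * (q^3 * a - q^3)"
  shows "v * ((q - 1) * (q^2 - 1) * (q^3 - 1)) = (q^3 * a - 1) * (q^2 * a - 1) * (q * a - 1)"
    and "(k + 1) * (q - 1)^2 \<le> (q^3 - 1) * q * a"
proof -
  have "v * ((q - 1) * (q^2 - 1) * (q^3 - 1)) * q^3
      = (q^3 * a - 1) * (q^2 * a - 1) * (q * a - 1) * q^3"
    using v by algebra
  then show "v * ((q - 1) * (q^2 - 1) * (q^3 - 1)) = (q^3 * a - 1) * (q^2 * a - 1) * (q * a - 1)"
    using q by simp
  have "k * (q - 1) * q^2 = (q^2 + q + 1) * q * (a - 1) * q^2"
    using k by algebra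
  then have "k * (q - 1) = (q^2 + q + 1) * q * (a - 1)"
    using q by simp
  \<comment> \<open>The added 1 contributes (q - 1)^2, which is absorbed by the term q (q^3 - 1)
    split off from a - 1.\<close>
  then have "(k + 1) * (q - 1)^2 = (q^3 - 1) * q * a - (q * (q^3 - 1) - (q - 1)^2)"
    by algebra
  moreover have "(q - 1)^2 \<le> q * (q^3 - 1)"
  proof -
    have "(q - 1)^2 = (q - 1) * (q - 1)" by (simp add: power2_eq_square)
    also have "\<dots> \<le> q * (q^3 - 1)"
      using q self_le_power[of q 3] by (intro mult_mono) auto
    finally show ?thesis .
  qed
  ultimately show "(k + 1) * (q - 1)^2 \<le> (q^3 - 1) * q * a" by simp
qed

text \<open>It suffices that (k + 1) q (a - 1) \<le> v (q^2 - 1). Multiplied by (q - 1)^2 (q^3 - 1)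
  and with k + 1 replaced by its upper bound, both sides become products of three factors that
  compare one by one.\<close>

lemma card_lower_bound_ge_8:
  fixes q a v k m :: real
  assumes q: "q \<ge> 2" and a: "a \<ge> q^2"
    and v: "v * ((q - 1) * (q^2 - 1) * (q^3 - 1) * q^3)
      = (q^3 * a - 1) * (q^3 * a - q) * (q^3 * a - q^2)"
    and k: "k * (q^3 - q^2) = (q^2 + q + 1) * (q^3 * a - q^3)" "k \<ge> 0"
    and m: "v \<le> m * (k + 1)"
  shows "q * (a - 1) / (q^2 - 1) \<le> m"
proof -
  have q2: "q^2 \<ge> 2 * q" using q by (simp add: power2_eq_square)
  have q3: "q^3 > 1" and q21: "q^2 > 1" using q by (auto intro!: one_less_power)
  have a1: "a \<ge> 1" using a q21 by simp
  note aux = plane_counts_bounds[OF q a1 v k(1)]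
  have "(k + 1) * (q * (a - 1)) * ((q - 1)^2 * (q^3 - 1))
      \<le> (q^3 - 1) * q * a * (q * (a - 1)) * (q^3 - 1)"
    using mult_right_mono[OF aux(2), of "q * (a - 1) * (q^3 - 1)"] q q3 a1
    by (simp add: mult_ac)
  also have "\<dots> = ((q^3 - 1) * a) * ((q^3 - 1) * q) * (q * (a - 1))"
    by (simp add: mult_ac)
  also have "\<dots> \<le> (q^3 * a - 1) * ((q - 1) * (q^2 * a - 1)) * (q * a - 1)"
  proof (rule mult_mono[OF mult_mono])
    have "q^2 * a \<ge> q^2 * q^2" using a by (intro mult_left_mono) auto
    \<comment> \<open>This is the sharp spot of the estimate: at q = 2 it reads 16 \<ge> 15.\<close>
    moreover have "q^2 * q^2 \<ge> q^3 + q^2 + q + 1"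
    proof -
      have "q^2 * q^2 \<ge> 2 * q * q^2" using q2 by (intro mult_right_mono) auto
      moreover have "q * q^2 \<ge> 2 * q^2" using q by (intro mult_right_mono) auto
      moreover have "q * q^2 = q^3" "2 * q * q^2 = 2 * q^3" "q * 2 \<le> q * q"
        using q by (simp_all add: power3_eq_cube power2_eq_square)
      ultimately show ?thesis using q q2 by linarith
    qed
    ultimately have "(q - 1) * (q^3 + q^2 + q) \<le> (q - 1) * (q^2 * a - 1)"
      using q by (intro mult_left_mono) auto
    moreover have "(q - 1) * (q^3 + q^2 + q) = (q^3 - 1) * q" by algebra
    ultimately show "(q^3 - 1) * q \<le> (q - 1) * (q^2 * a - 1)" by simp
    have "1 * 1 \<le> q^3 * a" using q q3 a1 by (intro mult_mono) auto
    then show "0 \<le> q^3 * a - 1" by simp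
    have "1 * 1 \<le> q^2 * a" using q21 a1 by (intro mult_mono) auto
    then show "0 \<le> (q^3 * a - 1) * ((q - 1) * (q^2 * a - 1))"
      using q \<open>0 \<le> q^3 * a - 1\<close> by simp
    show "(q^3 - 1) * a \<le> q^3 * a - 1" "q * (a - 1) \<le> q * a - 1"
      using q a1 by (simp_all add: algebra_simps)
  qed (use q q3 a1 in auto)
  also have "\<dots> = v * (q^2 - 1) * ((q - 1)^2 * (q^3 - 1))"
    using aux(1) by algebra
  finally have "(k + 1) * (q * (a - 1)) \<le> v * (q^2 - 1)"
    using q q3 by (subst (asm) mult_le_cancel_right_pos) auto
  also have "\<dots> \<le> m * (k + 1) * (q^2 - 1)"
    using m q21 by (intro mult_right_mono) auto
  finally have "(k + 1) * (q * (a - 1)) \<le> (k + 1) * (m * (q^2 - 1))" by (simp add: mult_ac)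
  then have "q * (a - 1) \<le> m * (q^2 - 1)"
    using k(2) by (subst (asm) mult_le_cancel_left_pos) auto
  then show ?thesis using q21 by (simp add: pos_divide_le_eq)
qed

text \<open>The same comparison with a = q^4 and a larger target. It needs q \<ge> 3: at q = 2 the
  inequality 11811 \<le> 211 m yields only m \<ge> 56, short of 63.\<close>

lemma card_lower_bound_6:
  fixes q v k m :: real
  assumes q: "q \<ge> 3"
    and v: "v * ((q - 1) * (q^2 - 1) * (q^3 - 1) * q^3)
      = (q^7 - 1) * (q^7 - q) * (q^7 - q^2)"
    and k: "k * (q^3 - q^2) = (q^2 + q + 1) * (q^7 - q^3)" "k \<ge> 0"
    and m: "v \<le> m * (k + 1)"
  shows "(q + 1)^2 * (q^2 + q + 1) \<le> m"
proof -
  let ?b = "(q + 1)^2 * (q^2 + q + 1)"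
  have q2: "q^2 \<ge> 3 * q" using q by (simp add: power2_eq_square)
  have q3: "q^3 > 1" and q21: "q^2 > 1" and q4: "q^4 \<ge> 1"
    using q by (auto intro!: one_less_power)
  have "q^3 * q^4 = q^7" by simp
  have q_ge_2: "q \<ge> 2" using q by simp
  note aux = plane_counts_bounds[of q "q^4" v k, unfolded \<open>q^3 * q^4 = q^7\<close>, OF q_ge_2 q4 v k(1)]
  have "(k + 1) * ?b * ((q - 1)^2 * (q^2 - 1) * (q^3 - 1))
      \<le> (q^3 - 1) * q * q^4 * (?b * (q^2 - 1) * (q^3 - 1))"
  proof -
    have "(k + 1) * (q - 1)^2 * (?b * (q^2 - 1) * (q^3 - 1))
        \<le> (q^3 - 1) * q * q^4 * (?b * (q^2 - 1) * (q^3 - 1))"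
      using q q3 q21 by (intro mult_right_mono aux(2) mult_nonneg_nonneg) auto
    then show ?thesis by (simp only: mult_ac)
  qed
  also have "\<dots> = (q^3 - 1) * q^4 * ((q^3 - 1) * (q^2 - 1)) * (q * ?b)"
    by (simp add: mult_ac)
  \<comment> \<open>The right side is (q - 1)(q^7 - 1)(q^6 - 1)(q^5 - 1), with q^6 - 1 = (q^3 - 1)(q
    + 1)(q^2 - q + 1) distributed so that the middle factors agree on both sides.\<close>
  also have "\<dots> \<le> (q^7 - 1) * ((q^3 - 1) * (q^2 - 1)) * ((q^2 - q + 1) * (q^5 - 1))"
  proof (rule mult_mono[OF mult_mono])
    have q7: "q^3 * q^4 = q^7" "1 \<le> q^7" using q by (simp_all flip: power_add)
    then show "(q^3 - 1) * q^4 \<le> q^7 - 1" "0 \<le> q^7 - 1"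
      using q4 by (simp_all add: algebra_simps)
    show "0 \<le> (q^7 - 1) * ((q^3 - 1) * (q^2 - 1))"
      using q7 q3 q21 by (intro mult_nonneg_nonneg) auto
    have "(q + 1)^2 = q^2 + 2 * q + 1" by algebra
    then have "(q + 1)^2 \<le> 2 * q^2 - 1" using q q2 by linarith
    then have "2 * q * (q + 1)^2 \<le> 2 * q * (2 * q^2 - 1)"
      using q by (intro mult_left_mono) auto
    also have "\<dots> \<le> 4 * q^3 - 1"
      using q by (simp add: algebra_simps power3_eq_cube power2_eq_square)
    also have "\<dots> \<le> q^2 * q^3 - 1"
      using q q2 q3 by (intro diff_right_mono mult_right_mono) auto
    also have "\<dots> = q^5 - 1" by simp
    finally have q5: "2 * q * (q + 1)^2 \<le> q^5 - 1" .
    \<comment> \<open>For q \<ge> 3 one has q^2 + q + 1 \<le> 2 (q^2 - q + 1), which reduces the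
      last comparison to \<open>q5\<close>.\<close>
    have "(q^2 + q + 1) * (q * (q + 1)^2) \<le> (2 * (q^2 - q + 1)) * (q * (q + 1)^2)"
      using q q2 by (intro mult_right_mono) auto
    also have "\<dots> = (q^2 - q + 1) * (2 * q * (q + 1)^2)" by simp
    also have "\<dots> \<le> (q^2 - q + 1) * (q^5 - 1)"
      using q q2 q5 by (intro mult_left_mono) auto
    finally show "q * ?b \<le> (q^2 - q + 1) * (q^5 - 1)" by (simp add: mult_ac)
  qed (use q q3 q21 q4 in auto)
  also have "\<dots> = v * ((q - 1)^2 * (q^2 - 1) * (q^3 - 1))"
    using aux(1) by algebra
  finally have "(k + 1) * ?b \<le> v"
    using q q3 q21 by (subst (asm) mult_le_cancel_right_pos) auto
  also have "\<dots> \<le> (k + 1) * m" using m by (simp add: mult_ac)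
  finally show ?thesis
    using k(2) by (subst (asm) mult_le_cancel_left_pos) auto
qed

lemma card_lower_bound_6_order_2:
  fixes m h1 h2 :: int
  assumes eq: "m * (210 - h1 + h2) = 11811 * h2"
    and "0 \<le> h1" "h1 \<le> m" "0 < h2" "h2 \<le> m"
  shows "63 \<le> m"
proof (rule ccontr)
  assume "\<not> 63 \<le> m"
  then have m: "m < 63" by simp
  have "prime (127::int)" by simp
  moreover have "127 dvd m * (210 - h1 + h2)"
    unfolding eq by (rule dvdI[of _ _ "93 * h2"]) simp
  ultimately have "127 dvd m \<or> 127 dvd 210 - h1 + h2"
    by (rule prime_dvd_multD)
  moreover have "\<not> 127 dvd m"
    using m assms by (auto dest: zdvd_imp_le)
  ultimately obtain c where c: "210 - h1 + h2 = 127 * c" by auto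
  \<comment> \<open>With m \<le> 62 the number 210 - h1 + h2 lies between 149 and 272, and 254 is
    the only multiple of 127 there.\<close>
  have "127 * c < 127 * 3" "127 * 1 < 127 * c"
    using m assms(2-5) unfolding c[symmetric] by linarith+
  then have "c = 2" by simp
  then have *: "2 * m = 93 * h2" using eq c by simp
  \<comment> \<open>93 h2 = 2 m < 126 leaves only h2 = 1, and then 2 m = 93 fails by parity.\<close>
  then have "h2 = 1" using m \<open>0 < h2\<close> by linarith
  then show False using arg_cong[OF *, of even] by simp
qed

section \<open>Assembling the bounds for n = 6 and n \<ge> 8\<close>

theorem theorem1p2:
  fixes q n :: nat
    and L :: "('a::{field,finite} ^ 'd::finite) set set"
  assumes "primepow q" and "CARD('a) = q"
    and "CARD('d) = n + 1"
    and "n \<ge> 6" and "even n"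
    and "intriguing planes meet_in_line L"
    and "nontrivial_vertex_set planes L"
    and "\<not> tight planes meet_in_line L"
  shows "(n = 6 \<longrightarrow>
            real (card L) \<ge> (real q + 1)^2 * (real q ^ 3 - 1) / (real q - 1)) \<and>
         (n \<ge> 8 \<longrightarrow>
            real (card L) \<ge> real q * (real q ^ (n - 2) - 1) / (real q ^ 2 - 1))"
proof -
  obtain h1 h2 where h: "intriguing_with planes meet_in_line h1 h2 L"
    using assms(6) by (auto simp: intriguing_def)
  have q: "real q \<ge> 2"
    using card_field_gt_1[where 'a='a] assms(2) by simp
  define v where "v = card (planes :: ('a ^ 'd) set set)"
  define Q where "Q = real q"
  have Q: "Q \<ge> 2" using q by (simp add: Q_def)
  then have Q23: "Q^3 - Q^2 > 0" by (simp add: power_strict_increasing)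
  have v: "real v * ((Q - 1) * (Q^2 - 1) * (Q^3 - 1) * Q^3)
      = (Q^(n + 1) - 1) * (Q^(n + 1) - Q) * (Q^(n + 1) - Q^2)"
    using card_planes[where 'a='a and 'd='d] assms(2,3) by (simp add: v_def Q_def)
  obtain U W :: "('a ^ 'd) set" where UW: "U \<in> L" "W \<in> planes - L" "meet_in_line U W"
  proof -
    have "L \<subseteq> planes" using h by (simp add: intriguing_with_def)
    then show ?thesis
      using assms(7) planes_connected[of _ L] that
      by (metis nontrivial_vertex_set_def all_not_in_conv subsetI subset_antisym)
  qed
  define k where "k = card (neighbours planes meet_in_line U)"
  have "U \<in> planes" using UW(1) h by (auto simp: intriguing_with_def)
  have deg: "real (card (neighbours planes meet_in_line P)) * (Q^3 - Q^2)
      = (Q^2 + Q + 1) * (Q^(n + 1) - Q^3)" if "P \<in> planes" for P :: "('a ^ 'd) set"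
    using card_neighbours_plane[OF that] assms(2,3) by (simp add: Q_def)
  have k: "real k * (Q^3 - Q^2) = (Q^2 + Q + 1) * (Q^(n + 1) - Q^3)"
    unfolding k_def by (rule deg) fact
  \<comment> \<open>The right side of \<open>deg\<close> is the same for every plane, and the
    positive factor Q^3 - Q^2 cancels.\<close>
  have reg: "card (neighbours planes meet_in_line P) = k" if "P \<in> planes" for P :: "('a ^ 'd) set"
  proof -
    have "real (card (neighbours planes meet_in_line P)) * (Q^3 - Q^2) = real k * (Q^3 - Q^2)"
      using deg[OF that] k by simp
    then show ?thesis using Q23 by simp
  qed
  have sym: "meet_in_line A B \<Longrightarrow> meet_in_line B A" for A B :: "('a ^ 'd) set"
    by (auto simp: meet_in_line_def Int_commute)
  note bounds = nontrivial_intriguing_bounds[OF _ sym reg h assms(7) UW, simplified, folded v_def]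
  have m: "real v \<le> real (card L) * (real k + 1)"
    using bounds(4) of_nat_mono[of v "card L * (k + 1)", where 'a=real]
    by (simp add: algebra_simps)
  show ?thesis
  proof (intro conjI impI)
    assume n: "n = 6"
    have "(Q + 1)^2 * (Q^2 + Q + 1) \<le> card L"
    proof (cases "q = 2")
      case True
      then have "v = 11811" "k = 210" using v k n by (simp_all add: Q_def)
      then have "int (card L) * (210 - int h1 + int h2) = 11811 * int h2"
        using intriguing_count[OF _ sym reg h] by (simp add: v_def)
      then have "63 \<le> int (card L)"
        using bounds by (intro card_lower_bound_6_order_2[of _ "int h1" "int h2"]) auto
      then show ?thesis using True by (simp add: Q_def)
    next
      case False
      then have "Q \<ge> 3" using q by (simp add: Q_def)
      then show ?thesis
        using v k n m by (intro card_lower_bound_6[of Q "real v" "real k"]) auto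
    qed
    also have "(Q + 1)^2 * (Q^2 + Q + 1) = (Q + 1)^2 * (Q^3 - 1) / (Q - 1)"
      using Q by (simp add: field_simps) algebra
    finally show "(real q + 1)^2 * (real q ^ 3 - 1) / (real q - 1) \<le> real (card L)"
      by (simp add: Q_def)
  next
    assume n: "8 \<le> n"
    \<comment> \<open>This brings \<open>v\<close> and \<open>k\<close> into the form of the
      estimate with a = Q^(n - 2).\<close>
    have "n + 1 = 3 + (n - 2)" using n by simp
    then have Qn: "Q^(n + 1) = Q^3 * Q^(n - 2)" by (metis power_add)
    have "Q^2 \<le> Q^(n - 2)" using Q n by (intro power_increasing) auto
    from card_lower_bound_ge_8[OF Q this v[unfolded Qn] k[unfolded Qn] _ m]
    show "real q * (real q ^ (n - 2) - 1) / (real q ^ 2 - 1) \<le> real (card L)"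
      by (simp add: Q_def)
  qed
qed

end
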